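(* For $n\in\mathbb{N}$ let $a_{21,3}(n)$ be the number of occurrences of the block $21$ in the base $3$ expansion of $n$. The infinite product below converges (as the limit of its partial products) and $$\prod_{n\geq 1}\left(\frac{9n+7}{9n+8}\right)^{(-1)^{a_{21,3}(n)}}=\frac{8}{7\sqrt{3}}.$$
   Context: $\mathbb{N}$ is the set of non-negative integers. The block $21$ means the digit $2$ immediately followed by the digit $1$, reading the expansion from the most significant digit; e.g. $a_{21,3}(7)=1$ since $7$ is written $21$ in base $3$. *)

theory Defs
  imports Complex_Main
begin

(* Digits of n in base b, most significant first and without leading zeros.
   The number 0 has the empty expansion, and so do all n in the degenerate bases b < 2. *)
function base_expansion :: "nat \<Rightarrow> nat \<Rightarrow> nat list" where
  "base_expansion b n =
     (if b < 2 \<or> n = 0 then [] else base_expansion b (n div b) @ [n mod b])"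
  by auto
termination
  by (relation "measure snd") auto

declare base_expansion.simps [simp del]

lemma horner_sum_base_expansion:
  assumes "2 \<le> b"
  shows "horner_sum id b (rev (base_expansion b n)) = n"
  using assms
proof (induction b n rule: base_expansion.induct)
  case (1 b n)
  then show ?case
    by (subst base_expansion.simps) (auto simp: id_def)
qed

lemma base_expansion_digit_less: "d \<in> set (base_expansion b n) \<Longrightarrow> d < b"
proof (induction b n rule: base_expansion.induct)
  case (1 b n)
  then show ?case
    by (subst (asm) (2) base_expansion.simps) (auto split: if_splits)
qed

lemma hd_base_expansion:
  assumes "2 \<le> b" "0 < n"
  shows "base_expansion b n \<noteq> [] \<and> hd (base_expansion b n) \<noteq> 0"
  using assms
proof (induction b n rule: base_expansion.induct)
  case (1 b n)
  show ?case
  proof (cases "n < b")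
    case True
    with 1 show ?thesis
      by (subst (1 2) base_expansion.simps) (auto simp: base_expansion.simps [of b 0])
  next
    case False
    with 1 have "0 < n div b"
      by (simp add: div_greater_zero_iff)
    with 1 have "base_expansion b (n div b) \<noteq> [] \<and> hd (base_expansion b (n div b)) \<noteq> 0"
      by auto
    with 1 show ?thesis
      by (subst (1 2) base_expansion.simps) auto
  qed
qed

(* Occurrences are counted by starting position, so they may overlap. *)
definition count_block :: "'a list \<Rightarrow> 'a list \<Rightarrow> nat" where
  "count_block w xs =
     card {i. i + length w \<le> length xs \<and> take (length w) (drop i xs) = w}"

definition block_occurrences :: "nat list \<Rightarrow> nat \<Rightarrow> nat \<Rightarrow> nat" where
  "block_occurrences w b n = count_block w (base_expansion b n)"

lemma block_occurrences_21_3_7: "block_occurrences [2, 1] 3 7 = 1"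
proof -
  have "base_expansion 3 7 = [2, 1]"
    by (simp add: base_expansion.simps)
  moreover have "{i::nat. i + 2 \<le> 2 \<and> take 2 (drop i [2, 1]) = [2, 1::nat]} = {0}"
    by auto
  ultimately show ?thesis
    by (simp add: block_occurrences_def count_block_def)
qed

end

theory Submission
  imports Defs
begin

text \<open>
  Write \<open>\<epsilon> n\<close> for the sign \<open>(-1)\<close> to the number of blocks \<open>21\<close> in the ternary expansion of \<open>n\<close>.
  Appending a digit to an expansion preserves the sign, except that appending \<open>1\<close> after a last
  digit \<open>2\<close> flips it. Grouping \<open>n\<close> by its last digit therefore gives, for every function \<open>f\<close>,

  \<open>(\<Sum>n<9M. \<epsilon> n * f n) = (\<Sum>n<3M. \<epsilon> n * (f (3n) + f (3n+1) + f (3n+2))) - 2 * (\<Sum>m<M. \<epsilon> m * f (9m+7))\<close>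

  (lemma \<open>sum_block_sign_split\<close>), and everything rests on using this identity twice.

  For \<open>f n = ln ((n+1)/n)\<close> the three terms telescope, \<open>f (3n) + f (3n+1) + f (3n+2) = f n\<close> for
  \<open>n \<ge> 1\<close>, while the last sum is the negated logarithm of the partial product, including its
  factor for \<open>m = 0\<close>. What remains is the term \<open>f 1 + f 2 = ln 3\<close> coming from \<open>n = 0\<close> and the
  sum of \<open>\<epsilon> n * f n\<close> over \<open>3M \<le> n < 9M\<close>. If the latter tends to \<open>0\<close>, the logarithm of the
  product is \<open>ln (8/7) - ln 3 / 2\<close>, as required.

  For \<open>f = 1\<close> the identity is a recursion \<open>A (9M) = 3 * A (3M) - 2 * A M\<close> for the summatory function
  \<open>A\<close> of \<open>\<epsilon>\<close>. Its characteristic roots are \<open>1\<close> and \<open>2\<close>, both smaller than \<open>3\<close>, so \<open>A n\<close> is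
  of smaller order than \<open>n\<close> (lemma \<open>block_sign_sum_bound\<close>). Since \<open>f n\<close> decreases and is at most
  \<open>1/n\<close>, summation by parts shows that the sum over \<open>3M \<le> n < 9M\<close> vanishes in the limit.
\<close>

section \<open>The sign of an expansion\<close>

lemma count_block_pair_snoc:
  "count_block [a, b] (xs @ [d]) =
     count_block [a, b] xs + (if xs \<noteq> [] \<and> last xs = a \<and> d = b then 1 else 0)"
proof -
  have pair: "take 2 (drop i ys) = [a, b] \<longleftrightarrow> ys ! i = a \<and> ys ! Suc i = b"
    if "i + 2 \<le> length ys" for i and ys :: "'a list"
  proof -
    have "drop i ys = ys ! i # ys ! Suc i # drop (Suc (Suc i)) ys"
      using that by (simp add: Cons_nth_drop_Suc)
    then show ?thesis by (simp add: numeral_2_eq_2)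
  qed
  define P where "P ys = {i. i + 2 \<le> length ys \<and> ys ! i = a \<and> ys ! Suc i = b}" for ys :: "'a list"
  have count: "count_block [a, b] ys = card (P ys)" for ys
  proof -
    have "{i. i + length [a, b] \<le> length ys \<and> take (length [a, b]) (drop i ys) = [a, b]} = P ys"
      unfolding P_def using pair by (auto simp: numeral_2_eq_2)
    then show ?thesis by (simp add: count_block_def)
  qed
  have fin: "finite (P xs)"
    by (rule finite_subset[of _ "{..length xs}"]) (auto simp: P_def)
  have notin: "length xs - 1 \<notin> P xs"
    by (auto simp: P_def)
  have "P (xs @ [d]) = P xs \<union> (if xs \<noteq> [] \<and> last xs = a \<and> d = b then {length xs - 1} else {})"
  proof (rule set_eqI)
    fix i
    consider "i + 2 \<le> length xs" | "i + 1 = length xs" | "i + 1 > length xs"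
      by linarith
    then show "i \<in> P (xs @ [d]) \<longleftrightarrow>
        i \<in> P xs \<union> (if xs \<noteq> [] \<and> last xs = a \<and> d = b then {length xs - 1} else {})"
    proof cases
      case 1
      then show ?thesis by (auto simp: P_def nth_append)
    next
      case 2
      then have "xs \<noteq> []" "i = length xs - 1" "Suc i = length xs" by auto
      then show ?thesis by (auto simp: P_def nth_append last_conv_nth)
    next
      case 3
      then have "i \<ge> length xs" by simp
      then show ?thesis by (cases xs) (auto simp: P_def)
    qed
  qed
  then show ?thesis using fin notin by (auto simp: count)
qed

lemma block_occurrences_21_append_digit:
  assumes "r < 3"
  shows "block_occurrences [2, 1] 3 (3 * n + r) =
     block_occurrences [2, 1] 3 n + (if n mod 3 = 2 \<and> r = 1 then 1 else 0)"
proof (cases "3 * n + r = 0")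
  case True
  then show ?thesis by simp
next
  case False
  have "base_expansion 3 (3 * n + r) = base_expansion 3 n @ [r]"
    using False assms by (subst base_expansion.simps) auto
  moreover have "base_expansion 3 n \<noteq> [] \<and> last (base_expansion 3 n) = 2 \<longleftrightarrow> n mod 3 = 2"
    by (subst (1 2) base_expansion.simps) auto
  ultimately show ?thesis
    by (auto simp: block_occurrences_def count_block_pair_snoc)
qed

definition block_sign :: "nat \<Rightarrow> real" where
  "block_sign n = (-1) ^ block_occurrences [2, 1] 3 n"

lemma abs_block_sign [simp]: "\<bar>block_sign n\<bar> = 1"
  by (simp add: block_sign_def power_abs)

lemma block_sign_0 [simp]: "block_sign 0 = 1"
  by (simp add: block_sign_def block_occurrences_def count_block_def base_expansion.simps)

lemma block_sign_append_digit:
  "block_sign (3 * n) = block_sign n"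
  "block_sign (3 * n + 1) = (if n mod 3 = 2 then - block_sign n else block_sign n)"
  "block_sign (3 * n + 2) = block_sign n"
  using block_occurrences_21_append_digit[of 0 n] block_occurrences_21_append_digit[of 1 n]
    block_occurrences_21_append_digit[of 2 n]
  by (auto simp: block_sign_def)

text \<open>
  The indices carrying a flipped sign are \<open>3 * n + 1\<close> with \<open>n = 3 * m + 2\<close>, that is \<open>9 * m + 7\<close>, and
  there the sign is \<open>- block_sign m\<close>. The last sum corrects for the flip, hence its factor \<open>2\<close>.
\<close>
lemma sum_block_sign_split:
  "(\<Sum>n<9*M. block_sign n * f n) =
     (\<Sum>n<3*M. block_sign n * (f (3*n) + f (3*n+1) + f (3*n+2)))
       - 2 * (\<Sum>m<M. block_sign m * f (9*m+7))"
proof (induction M)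
  case 0
  show ?case by simp
next
  case (Suc M)
  define s where "s = block_sign M"
  define t where "t = block_sign (3 * M + 1)"
  have idx: "3*(3*M) = 9*M" "3*(3*M+1) = 9*M+3" "3*(3*M+2) = 9*M+6"
    "9*M+3+1 = 9*M+4" "9*M+3+2 = 9*M+5" "9*M+6+1 = 9*M+7" "9*M+6+2 = 9*M+8"
    by simp_all
  have mods: "\<not> 3*M mod 3 = 2" "\<not> (3*M+1) mod 3 = 2" "(3*M+2) mod 3 = 2"
    by presburger+
  have lower: "block_sign (3*M) = s" "block_sign (3*M+1) = t" "block_sign (3*M+2) = s"
    using block_sign_append_digit(1,3)[of M] by (simp_all only: s_def t_def)
  have upper: "block_sign (9*M) = s" "block_sign (9*M+1) = s" "block_sign (9*M+2) = s"
    "block_sign (9*M+3) = t" "block_sign (9*M+4) = t" "block_sign (9*M+5) = t"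
    "block_sign (9*M+6) = s" "block_sign (9*M+7) = - s" "block_sign (9*M+8) = s"
    using block_sign_append_digit[of "3*M"] block_sign_append_digit[of "3*M+1"]
      block_sign_append_digit[of "3*M+2"]
    by (simp_all only: idx mods lower simp_thms if_True if_False)
  have nine: "(\<Sum>n<9*Suc M. h n) = (\<Sum>n<9*M. h n) + h (9*M) + h (9*M+1) + h (9*M+2)
      + h (9*M+3) + h (9*M+4) + h (9*M+5) + h (9*M+6) + h (9*M+7) + h (9*M+8)" for h :: "nat \<Rightarrow> real"
    by (simp add: eval_nat_numeral)
  have three: "(\<Sum>n<3*Suc M. h n) = (\<Sum>n<3*M. h n) + h (3*M) + h (3*M+1) + h (3*M+2)"
    for h :: "nat \<Rightarrow> real"
    by (simp add: eval_nat_numeral)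
  show ?case
    unfolding nine three Suc.IH sum.lessThan_Suc idx upper lower s_def[symmetric]
    by (simp add: algebra_simps)
qed

section \<open>The summatory function of the sign\<close>

definition block_sign_sum :: "nat \<Rightarrow> real" where
  "block_sign_sum N = (\<Sum>n<N. block_sign n)"

lemma block_sign_sum_rec:
  "block_sign_sum (9 * M) = 3 * block_sign_sum (3 * M) - 2 * block_sign_sum M"
  using sum_block_sign_split[where f = "\<lambda>_. 1" and M = M]
  by (simp add: block_sign_sum_def sum_distrib_left mult.commute)

lemma block_sign_sum_diff_le: "\<bar>block_sign_sum (a + r) - block_sign_sum a\<bar> \<le> real r"
proof (induction r)
  case (Suc r)
  have "block_sign_sum (a + Suc r) = block_sign_sum (a + r) + block_sign (a + r)"
    by (simp add: block_sign_sum_def)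
  then show ?case
    using Suc.IH abs_block_sign[of "a + r"] by linarith
qed simp

text \<open>
  The recursion is solved along powers of three: \<open>A (3x) - A x\<close> is an eigenvector for the
  characteristic root \<open>2\<close>, and the other root is \<open>1\<close>.
\<close>
lemma block_sign_sum_power:
  "block_sign_sum (3 ^ k * q) =
     block_sign_sum q + (2 ^ k - 1) * (block_sign_sum (3 * q) - block_sign_sum q)"
proof -
  let ?D = "\<lambda>x. block_sign_sum (3 * x) - block_sign_sum x"
  have D: "?D (3 ^ k * q) = 2 ^ k * ?D q" for k
  proof (induction k)
    case (Suc k)
    then show ?case
      using block_sign_sum_rec[of "3 ^ k * q"] by (simp add: mult.assoc algebra_simps)
  qed simp
  show ?thesis
  proof (induction k)
    case (Suc k)
    then show ?case
      using D[of k] by (simp add: mult.assoc algebra_simps)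
  qed simp
qed

text \<open>
  Choosing \<open>k\<close> large and then \<open>n\<close> large makes the bound an arbitrarily small multiple of \<open>n\<close>.
  The second summand pays for rounding \<open>n\<close> down to a multiple of \<open>3 ^ k\<close>.
\<close>
lemma block_sign_sum_bound:
  "\<bar>block_sign_sum n\<bar> \<le> 5 * (2 / 3) ^ k * real n + 3 ^ k"
proof -
  define q where "q = n div 3 ^ k"
  define r where "r = n mod 3 ^ k"
  have n: "n = 3 ^ k * q + r" by (simp add: q_def r_def)
  have "r < 3 ^ k" by (simp add: r_def)
  then have r: "real r \<le> 3 ^ k"
    by (metis less_imp_le of_nat_le_iff of_nat_numeral of_nat_power)
  have A1: "\<bar>block_sign_sum q\<bar> \<le> real q"
    and A3: "\<bar>block_sign_sum (3 * q)\<bar> \<le> 3 * real q"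
    using block_sign_sum_diff_le[of 0 q] block_sign_sum_diff_le[of 0 "3 * q"]
    by (simp_all add: block_sign_sum_def)
  have D: "\<bar>block_sign_sum (3 * q) - block_sign_sum q\<bar> \<le> 4 * real q"
    using A1 A3 by linarith
  have "\<bar>(2 ^ k - 1) * (block_sign_sum (3 * q) - block_sign_sum q)\<bar> \<le> (2 ^ k - 1) * (4 * real q)"
    unfolding abs_mult using D by (intro mult_mono) auto
  then have "\<bar>block_sign_sum (3 ^ k * q)\<bar> \<le> real q + (2 ^ k - 1) * (4 * real q)"
    using A1 unfolding block_sign_sum_power by linarith
  also have "\<dots> \<le> 5 * 2 ^ k * real q"
  proof -
    have "1 * real q \<le> 2 ^ k * real q" by (intro mult_right_mono) auto
    then show ?thesis by (simp add: algebra_simps)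
  qed
  also have "\<dots> = 5 * (2 / 3) ^ k * (3 ^ k * real q)"
    by (simp add: power_divide)
  also have "\<dots> \<le> 5 * (2 / 3) ^ k * real n"
    by (intro mult_left_mono) (auto simp: n)
  finally have "\<bar>block_sign_sum (3 ^ k * q)\<bar> \<le> 5 * (2 / 3) ^ k * real n" .
  moreover have "\<bar>block_sign_sum n - block_sign_sum (3 ^ k * q)\<bar> \<le> 3 ^ k"
    using block_sign_sum_diff_le[of "3 ^ k * q" r] r unfolding n by linarith
  ultimately show ?thesis by linarith
qed

section \<open>Logarithmic sums over a bounded ratio\<close>

text \<open>Summation by parts against a decreasing weight: only the first weight matters.\<close>
lemma abs_sum_mult_decreasing_le:
  fixes c u :: "nat \<Rightarrow> real"
  assumes "a \<le> b"
    and dec: "\<And>n. a \<le> n \<Longrightarrow> u (Suc n) \<le> u n"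
    and nonneg: "\<And>n. a \<le> n \<Longrightarrow> 0 \<le> u n"
    and K: "\<And>m. m \<le> b \<Longrightarrow> \<bar>\<Sum>n<m. c n\<bar> \<le> K"
  shows "\<bar>\<Sum>n=a..<b. c n * u n\<bar> \<le> 2 * K * u a"
proof -
  define C where "C m = (\<Sum>n<m. c n)" for m
  have parts: "(\<Sum>n=a..<b. c n * u n) =
      C b * u b - C a * u a + (\<Sum>n=a..<b. C (Suc n) * (u n - u (Suc n)))"
    using \<open>a \<le> b\<close>
    by (induction b rule: dec_induct) (simp_all add: C_def algebra_simps)
  have "\<bar>\<Sum>n=a..<b. C (Suc n) * (u n - u (Suc n))\<bar> \<le> (\<Sum>n=a..<b. K * (u n - u (Suc n)))"
  proof (rule order_trans[OF sum_abs sum_mono])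
    fix n assume "n \<in> {a..<b}"
    then show "\<bar>C (Suc n) * (u n - u (Suc n))\<bar> \<le> K * (u n - u (Suc n))"
      using K[of "Suc n"] dec[of n] by (simp add: abs_mult C_def mult_right_mono)
  qed
  also have "\<dots> = K * (u a - u b)"
    using \<open>a \<le> b\<close> by (induction b rule: dec_induct) (simp_all add: algebra_simps)
  finally have "\<bar>\<Sum>n=a..<b. C (Suc n) * (u n - u (Suc n))\<bar> \<le> K * (u a - u b)" .
  moreover have "\<bar>C b * u b\<bar> \<le> K * u b"
    using K[of b] nonneg[of b] \<open>a \<le> b\<close> by (simp add: abs_mult C_def mult_right_mono)
  moreover have "\<bar>C a * u a\<bar> \<le> K * u a"
    using K[of a] nonneg[of a] \<open>a \<le> b\<close> by (simp add: abs_mult C_def mult_right_mono)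
  ultimately show ?thesis
    unfolding parts right_diff_distrib[of K] by linarith
qed

text \<open>
  This form of \<open>ln ((n + 1) / n)\<close> has the value \<open>0\<close> at \<open>n = 0\<close>, because \<open>1 / 0 = 0\<close>; sums may
  therefore start at \<open>0\<close>.
\<close>
definition log_step :: "nat \<Rightarrow> real" where
  "log_step n = ln (1 + 1 / real n)"

lemma log_step_eq:
  assumes "n > 0"
  shows "log_step n = ln (real n + 1) - ln (real n)"
proof -
  have "1 + 1 / real n = (real n + 1) / real n"
    using assms by (simp add: field_simps)
  then show ?thesis
    using assms by (simp add: log_step_def ln_div)
qed

lemma log_step_telescope:
  assumes "n > 0"
  shows "log_step (3 * n) + log_step (3 * n + 1) + log_step (3 * n + 2) = log_step n"
proof -
  have "log_step (3 * n) + log_step (3 * n + 1) + log_step (3 * n + 2) =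
      ln (3 * (real n + 1)) - ln (3 * real n)"
    using assms by (simp add: log_step_eq add.commute)
  also have "\<dots> = log_step n"
    using assms ln_mult[of 3 "real n + 1"] ln_mult[of 3 "real n"] by (simp add: log_step_eq)
  finally show ?thesis .
qed

lemma block_sign_log_tail_tendsto_0:
  "(\<lambda>M. \<Sum>n=3*M..<9*M. block_sign n * log_step n) \<longlonglongrightarrow> 0"
proof -
  have bound: "\<bar>\<Sum>n=3*M..<9*M. block_sign n * log_step n\<bar> \<le> 30 * (2 / 3) ^ k + 3 ^ k / real M"
    if "M > 0" for M k
  proof -
    define K where "K = 5 * (2 / 3) ^ k * (9 * real M) + 3 ^ k"
    have "K \<ge> 0" by (simp add: K_def)
    have "\<bar>\<Sum>n=3*M..<9*M. block_sign n * log_step n\<bar> \<le> 2 * K * log_step (3 * M)"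
    proof (rule abs_sum_mult_decreasing_le)
      fix n assume n: "3 * M \<le> n"
      then have "n > 0" using that by linarith
      then show "log_step (Suc n) \<le> log_step n"
        by (simp add: log_step_def frac_le add_pos_nonneg)
      show "0 \<le> log_step n"
        by (simp add: log_step_def)
    next
      fix m assume "m \<le> 9 * M"
      then have "5 * (2 / 3) ^ k * real m \<le> 5 * (2 / 3) ^ k * (9 * real M)"
        by (intro mult_left_mono) auto
      then show "\<bar>\<Sum>n<m. block_sign n\<bar> \<le> K"
        using block_sign_sum_bound[of m k] unfolding K_def block_sign_sum_def by linarith
    qed simp
    also have "\<dots> \<le> 2 * K * (1 / (3 * real M))"
      using \<open>K \<ge> 0\<close> ln_add_one_self_le_self[of "1 / (3 * real M)"]
      by (intro mult_left_mono) (simp_all add: log_step_def)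
    also have "\<dots> = 30 * (2 / 3) ^ k + 2 / 3 * (3 ^ k / real M)"
      using that by (simp add: K_def field_simps)
    also have "\<dots> \<le> 30 * (2 / 3) ^ k + 3 ^ k / real M"
      using that by (simp add: field_simps)
    finally show ?thesis .
  qed
  show ?thesis
  proof (rule LIMSEQ_I)
    fix e :: real
    assume "e > 0"
    then obtain k where k: "(2 / 3 :: real) ^ k < e / 60"
      using real_arch_pow_inv[of "e / 60" "2 / 3"] by auto
    obtain M0 :: nat where M0: "real M0 > 2 * 3 ^ k / e"
      using reals_Archimedean2 by blast
    have "M0 > 0"
      using M0 \<open>e > 0\<close> by (cases M0) (auto simp: divide_less_0_iff not_less field_simps)
    have "norm ((\<Sum>n=3*M..<9*M. block_sign n * log_step n) - 0) < e" if "M \<ge> M0" for M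
    proof -
      have "M > 0" using that \<open>M0 > 0\<close> by linarith
      have "2 * 3 ^ k / e < real M" using M0 that by linarith
      then have "3 ^ k / real M < e / 2"
        using \<open>M > 0\<close> \<open>e > 0\<close> by (simp add: field_simps)
      then show ?thesis
        using bound[OF \<open>M > 0\<close>, of k] k unfolding real_norm_def diff_0_right by linarith
    qed
    then show "\<exists>M0. \<forall>M\<ge>M0. norm ((\<Sum>n=3*M..<9*M. block_sign n * log_step n) - 0) < e"
      by blast
  qed
qed

section \<open>The infinite product\<close>

lemma log_partial_product:
  "(\<Sum>m=1..N. block_sign m * log_step (9 * m + 7)) =
     (ln 3 - (\<Sum>n=3*Suc N..<9*Suc N. block_sign n * log_step n)) / 2 - ln (8 / 7)"
proof -
  let ?f = "\<lambda>n. block_sign n * log_step n"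
  let ?g = "\<lambda>m. block_sign m * log_step (9 * m + 7)"
  have "log_step 0 + log_step 1 + log_step 2 = ln 3"
    using log_step_eq[of 1] log_step_eq[of 2] by (simp add: log_step_def)
  then have triple: "block_sign n * (log_step (3*n) + log_step (3*n+1) + log_step (3*n+2)) =
      ?f n + (if n = 0 then ln 3 else 0)" for n
    using log_step_telescope[of n] by (auto simp: log_step_def)
  have "(\<Sum>n<9*Suc N. ?f n) = (\<Sum>n<3*Suc N. ?f n) + ln 3 - 2 * (\<Sum>m<Suc N. ?g m)"
    unfolding sum_block_sign_split triple sum.distrib by simp
  moreover have "(\<Sum>n<9*Suc N. ?f n) = (\<Sum>n<3*Suc N. ?f n) + (\<Sum>n=3*Suc N..<9*Suc N. ?f n)"
    using sum.atLeastLessThan_concat[of 0 "3 * Suc N" "9 * Suc N" ?f]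
    by (simp only: lessThan_atLeast0)
  moreover have "(\<Sum>m<Suc N. ?g m) = ln (8 / 7) + (\<Sum>m=1..N. ?g m)"
    unfolding sum.lessThan_Suc_shift
    by (simp add: log_step_def sum.atLeast1_atMost_eq)
  moreover have "p = (l - t) / 2 - c" if "w = a + l - 2 * s" "w = a + t" "s = c + p"
    for w a l s t c p :: real
    using that by (simp add: field_simps)
  ultimately show ?thesis by blast
qed

lemma factor_eq_exp:
  "((9 * real n + 7) / (9 * real n + 8)) powi ((- 1 :: int) ^ block_occurrences [2, 1] 3 n) =
     exp (- (block_sign n * log_step (9 * n + 7)))"
proof -
  have pos: "9 * real n + 7 > 0" "9 * real n + 8 > 0" by auto
  have "exp (log_step (9 * n + 7)) = (9 * real n + 8) / (9 * real n + 7)"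
    using pos by (simp add: log_step_eq exp_diff add.commute)
  then show ?thesis
    using pos
    by (cases "even (block_occurrences [2, 1] 3 n)")
      (auto simp: block_sign_def exp_minus power_int_minus)
qed

theorem mainTheorem3:
  shows "(\<lambda>N. \<Prod>n = 1..N. ((9 * real n + 7) / (9 * real n + 8))
            powi ((- 1 :: int) ^ block_occurrences [2, 1] 3 n))
         \<longlonglongrightarrow> 8 / (7 * sqrt 3)"
proof -
  let ?T = "\<lambda>M. \<Sum>n=3*M..<9*M. block_sign n * log_step n"
  have prod: "(\<Prod>n = 1..N. ((9 * real n + 7) / (9 * real n + 8))
      powi ((- 1 :: int) ^ block_occurrences [2, 1] 3 n)) =
      exp (ln (8 / 7) - (ln 3 - ?T (Suc N)) / 2)" for N
    unfolding factor_eq_exp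
    by (simp only: exp_sum[symmetric] finite_atLeastAtMost sum_negf log_partial_product) simp
  have "(\<lambda>N. exp (ln (8 / 7) - (ln 3 - ?T (Suc N)) / 2)) \<longlonglongrightarrow> exp (ln (8 / 7) - (ln 3 - 0) / 2)"
    by (intro tendsto_intros LIMSEQ_Suc[OF block_sign_log_tail_tendsto_0]) simp
  moreover have "exp (ln (8 / 7) - (ln 3 - 0) / 2) = 8 / (7 * sqrt (3 :: real))"
    by (simp add: exp_diff ln_sqrt[symmetric])
  ultimately show ?thesis
    unfolding prod by simp
qed

end
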